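(* Let $q$ be a complex number with $|q|<1$. Then \begin{align*} \sum_{i,j\geq 0}\frac{(-1)^jq^{\frac{3j(3j+1)}{2}+i^2+3ij+i+j}}{(q;q)_i(q^3;q^3)_j}=\frac{1}{(q^2,q^3;q^6)_\infty}, \end{align*} where the sum runs over all pairs of nonnegative integers $(i,j)$.
   Context: Notation ($q$-Pochhammer symbols): for complex $a$ and a base $p$ with $|p|<1$, $(a;p)_0:=1$, $(a;p)_n:=\prod_{k=0}^{n-1}(1-ap^k)$ for integers $n\ge 1$, and $(a;p)_\infty:=\prod_{k=0}^{\infty}(1-ap^k)$. For several parameters, $(a_1,\dots,a_m;p)_\infty:=(a_1;p)_\infty\cdots(a_m;p)_\infty$. *)

theory Defs
  imports "HOL-Analysis.Analysis"
begin

definition qpoch :: "complex \<Rightarrow> complex \<Rightarrow> nat \<Rightarrow> complex" where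
  "qpoch a p n = (\<Prod>k<n. 1 - a * p ^ k)"

(* Meaningful for norm p < 1; prodinf allows vanishing factors, in which case the value is 0. *)
definition qpoch_inf :: "complex \<Rightarrow> complex \<Rightarrow> complex" where
  "qpoch_inf a p = (\<Prod>k. 1 - a * p ^ k)"

end

theory Submission
  imports Defs
begin

text \<open>
  Put \<open>n = i + 3j\<close>. The exponent of \<open>q\<close> in the double sum is
  \<open>n(n+1)/2 + i(i-1)/2 + i + j\<close>, so by Euler's expansions the sum is \<open>L((qz;q) / (qz\<^sup>3;q\<^sup>3))\<close>,
  where all products are infinite and \<open>L(f) = \<Sum> (-1)\<^sup>n q\<^bsup>n(n+1)/2\<^esup> f\<^sub>n\<close> for a power series \<open>f\<close> in \<open>z\<close>.
  Shifting the index shows that \<open>L\<close> annihilates every series \<open>q g(qz) + z g(z)\<close>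
  (\<open>gauss_sum_shift_zero\<close>).

  The sum in question contains no free parameter in which one could set up a recurrence. The key is
  to introduce one, in such a way that the value stays an infinite product:
  \<open>S(c) = L((qz;q) (cz\<^sup>2;q\<^sup>2) / ((qz\<^sup>2;q\<^sup>2) (cz\<^sup>3;q\<^sup>3)))\<close>,
  which is the original sum at \<open>c = q\<close>. An explicit \<open>g\<close> of the above kind proves
  \<open>S(c) = (1 - cq\<^sup>3) S(cq\<^sup>6)\<close> (\<open>deformed_sum_functional\<close>).

  Now expand \<open>S(c) = \<Sum> A\<^sub>m c\<^sup>m\<close>. On the one hand the functional equation gives
  \<open>A\<^sub>m = (-1)\<^sup>m q\<^bsup>3m\<^sup>2\<^esup> A\<^sub>0 / (q\<^sup>6;q\<^sup>6)\<^sub>m\<close> (\<open>reduced_coeff_recurrence\<close>). On the other hand the definition of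
  \<open>A\<^sub>m\<close> as a sum shows directly that \<open>(-1)\<^sup>m q\<^bsup>-3m\<^sup>2\<^esup> A\<^sub>m\<close> tends to
  \<open>(-q\<^sup>3;q\<^sup>3) / (q\<^sup>2;q\<^sup>2)\<close> (\<open>reduced_coeff_tendsto\<close>): as \<open>m\<close> grows, the exponent
  separates and only one of Euler's series is left. Together these determine \<open>A\<^sub>0\<close> and hence
  \<open>S(c) = (cq\<^sup>3;q\<^sup>6) / (q\<^sup>2, q\<^sup>3, q\<^sup>4;q\<^sup>6)\<close>. At \<open>c = q\<close> the numerator cancels \<open>(q\<^sup>4;q\<^sup>6)\<close>
  (\<open>deformed_sum_at_base\<close>).
\<close>

section \<open>Triangular exponents and q-Pochhammer symbols\<close>

lemma choose_two_Suc: "Suc n choose 2 = n + (n choose 2)"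
  by (simp add: numeral_2_eq_2)

lemma choose_two_0 [simp]: "0 choose 2 = 0"
  by (simp add: numeral_2_eq_2)

lemma choose_two_add: "(m + n) choose 2 = (m choose 2) + (n choose 2) + m * n"
  by (induction m) (simp_all add: choose_two_Suc)

lemma two_choose_two_Suc: "2 * (Suc n choose 2) = n * Suc n"
  by (induction n) (simp_all add: choose_two_Suc algebra_simps)

lemma qpoch_0 [simp]: "qpoch a p 0 = 1"
  by (simp add: qpoch_def)

lemma qpoch_Suc: "qpoch a p (Suc n) = qpoch a p n * (1 - a * p ^ n)"
  by (simp add: qpoch_def)

lemma one_minus_power_nonzero:
  fixes a p :: complex
  assumes "norm a < 1" "norm p < 1"
  shows "1 - a * p ^ k \<noteq> 0"
proof
  assume "1 - a * p ^ k = 0"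
  hence "norm a * norm p ^ k = 1" by (metis eq_iff_diff_eq_0 norm_mult norm_one norm_power)
  moreover have "norm a * norm p ^ k \<le> norm a * 1"
    using assms by (intro mult_left_mono power_le_one) auto
  ultimately show False using assms by simp
qed

lemma qpoch_nonzero:
  assumes "norm a < 1" "norm p < 1"
  shows "qpoch a p n \<noteq> 0"
  using one_minus_power_nonzero[OF assms] by (simp add: qpoch_def)

lemma convergent_prod_qpoch:
  fixes a p :: complex
  assumes "norm p < 1"
  shows "convergent_prod (\<lambda>k. 1 - a * p ^ k)"
proof (intro abs_convergent_prod_imp_convergent_prod summable_imp_abs_convergent_prod)
  have "summable (\<lambda>k. norm a * norm p ^ k)"
    using assms by (intro summable_mult summable_geometric) auto
  thus "summable (\<lambda>i. norm (1 - a * p ^ i - 1))"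
    by (simp add: norm_mult norm_power)
qed

lemma qpoch_tendsto:
  assumes "norm p < 1"
  shows "qpoch a p \<longlonglongrightarrow> qpoch_inf a p"
  using convergent_prod_LIMSEQ[OF convergent_prod_qpoch[OF assms, of a]]
  by (subst filterlim_sequentially_Suc [symmetric])
     (simp add: qpoch_def [abs_def] qpoch_inf_def lessThan_Suc_atMost)

lemma qpoch_inf_nonzero:
  assumes "norm a < 1" "norm p < 1"
  shows "qpoch_inf a p \<noteq> 0"
  unfolding qpoch_inf_def
  by (rule prodinf_nonzero[OF convergent_prod_qpoch]) (use assms one_minus_power_nonzero[OF assms] in auto)

lemma inverse_qpoch_tendsto:
  assumes "norm a < 1" "norm p < 1"
  shows "(\<lambda>n. 1 / qpoch a p n) \<longlonglongrightarrow> 1 / qpoch_inf a p"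
  by (intro tendsto_divide tendsto_const qpoch_tendsto qpoch_inf_nonzero assms)

text \<open>
  A convergent sequence is bounded; this uniform bound is the only size estimate on the
  denominators of the double series.
\<close>
lemma inverse_qpoch_bounded:
  assumes "norm a < 1" "norm p < 1"
  obtains M where "M > 0" "\<And>n. norm (1 / qpoch a p n) \<le> M"
  using inverse_qpoch_tendsto[OF assms, THEN convergentI, THEN convergent_imp_Bseq]
  unfolding Bseq_def by blast

lemma qpoch_inf_trisect:
  assumes "norm p < 1"
  shows "qpoch_inf a p = qpoch_inf a (p^3) * qpoch_inf (a * p) (p^3) * qpoch_inf (a * p^2) (p^3)"
proof (rule LIMSEQ_unique)
  have fin: "qpoch a p (3 * n) = qpoch a (p^3) n * qpoch (a * p) (p^3) n * qpoch (a * p^2) (p^3) n" for n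
  proof (induction n)
    case (Suc n)
    have "qpoch a p (3 * Suc n) = qpoch a p (3 * n) * (1 - a * p ^ (3 * n)) *
        (1 - a * (p * p ^ (3 * n))) * (1 - a * (p^2 * p ^ (3 * n)))"
      by (simp add: qpoch_Suc eval_nat_numeral mult_ac)
    thus ?case unfolding Suc.IH qpoch_Suc power_mult[of p 3 n]
      by (simp only: mult_ac)
  qed simp
  have "norm (p^3) < 1"
    using assms by (simp add: norm_power power_less_one_iff)
  then show "(\<lambda>n. qpoch a p (3 * n)) \<longlonglongrightarrow>
      qpoch_inf a (p^3) * qpoch_inf (a * p) (p^3) * qpoch_inf (a * p^2) (p^3)"
    unfolding fin by (intro tendsto_mult qpoch_tendsto)
  show "(\<lambda>n. qpoch a p (3 * n)) \<longlonglongrightarrow> qpoch_inf a p"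
    by (rule LIMSEQ_subseq_LIMSEQ[OF qpoch_tendsto[OF assms], unfolded o_def]) (simp add: strict_mono_def)
qed

text \<open>
  Euler's theorem that partitions into distinct parts and into odd parts are equinumerous, in the
  form \<open>(-p;p) (p;p\<^sup>2) = 1\<close>. Multiplying \<open>(-p;p)\<close> by \<open>(p;p)\<close> gives \<open>(p\<^sup>2;p\<^sup>2)\<close>, and
  \<open>(p;p)\<close> splits into its factors of odd and of even index.
\<close>
lemma euler_odd_parts:
  assumes "norm p < 1"
  shows "qpoch_inf (-p) p * qpoch_inf p (p^2) = 1"
proof -
  have p2: "norm (p^2) < 1"
    using assms by (simp add: norm_power power_less_one_iff)
  have fin1: "qpoch (-p) p n * qpoch p p n = qpoch (p^2) (p^2) n" for n
    by (induction n) (simp_all add: qpoch_Suc algebra_simps power2_eq_square power_mult_distrib flip: power_mult)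
  have fin2: "qpoch p p (2*n) = qpoch p (p^2) n * qpoch (p^2) (p^2) n" for n
    by (induction n) (simp_all add: qpoch_Suc power_mult power2_eq_square)
  have "qpoch_inf (-p) p * qpoch_inf p p = qpoch_inf (p^2) (p^2)"
    by (rule LIMSEQ_unique[OF tendsto_mult[OF qpoch_tendsto qpoch_tendsto]])
       (use assms p2 in \<open>auto simp: fin1 intro: qpoch_tendsto\<close>)
  moreover have "qpoch_inf p p = qpoch_inf p (p^2) * qpoch_inf (p^2) (p^2)"
  proof (rule LIMSEQ_unique)
    show "(\<lambda>n. qpoch p p (2 * n)) \<longlonglongrightarrow> qpoch_inf p (p^2) * qpoch_inf (p^2) (p^2)"
      unfolding fin2 by (intro tendsto_mult qpoch_tendsto p2)
    show "(\<lambda>n. qpoch p p (2 * n)) \<longlonglongrightarrow> qpoch_inf p p"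
      by (rule LIMSEQ_subseq_LIMSEQ[OF qpoch_tendsto[OF assms], unfolded o_def]) (simp add: strict_mono_def)
  qed
  ultimately show ?thesis
    using qpoch_inf_nonzero[OF p2 p2] by (simp add: mult.assoc [symmetric])
qed

section \<open>Substituting a monomial into a power series\<close>

text \<open>
  The substitution of \<open>c z\<^sup>d\<close> for the variable. The case \<open>d = 1\<close> is the dilation
  \<open>f(z) \<mapsto> f(q z)\<close> that occurs in q-difference equations.
\<close>
definition fps_subst :: "complex \<Rightarrow> nat \<Rightarrow> complex fps \<Rightarrow> complex fps" where
  "fps_subst c d f = f oo (fps_const c * fps_X ^ d)"

lemma fps_nth_subst:
  assumes "d > 0"
  shows "fps_nth (fps_subst c d f) n = (if d dvd n then fps_nth f (n div d) * c ^ (n div d) else 0)"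
proof -
  have "fps_nth (fps_subst c d f) n = (\<Sum>i\<in>{0..n}. if i * d = n then fps_nth f i * c ^ i else 0)"
    unfolding fps_subst_def fps_compose_nth
    by (intro sum.cong) (auto simp: power_mult_distrib fps_const_power fps_X_power_nth mult.commute simp flip: power_mult)
  also have "\<dots> = (if d dvd n then fps_nth f (n div d) * c ^ (n div d) else 0)"
  proof (cases "d dvd n")
    case True
    then obtain k where k: "n = d * k" by blast
    have "(\<Sum>i\<in>{0..n}. if i * d = n then fps_nth f i * c ^ i else 0) = (\<Sum>i\<in>{0..n}. if i = k then fps_nth f i * c ^ i else 0)"
      using assms k by (intro sum.cong) auto
    thus ?thesis using assms k by (auto simp: sum.delta)
  next
    case False
    thus ?thesis by (auto intro!: sum.neutral)
  qed
  finally show ?thesis .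
qed

lemma fps_subst_mult: "d > 0 \<Longrightarrow> fps_subst c d (f * g) = fps_subst c d f * fps_subst c d g"
  by (simp add: fps_subst_def fps_compose_mult_distrib)

lemma fps_subst_diff: "fps_subst c d (f - g) = fps_subst c d f - fps_subst c d g"
  by (simp add: fps_subst_def fps_compose_sub_distrib)

lemma fps_subst_const [simp]: "fps_subst c d (fps_const a) = fps_const a"
  by (simp add: fps_subst_def)

lemma fps_subst_one [simp]: "fps_subst c d 1 = 1"
  by (simp add: fps_subst_def)

lemma fps_subst_X: "d > 0 \<Longrightarrow> fps_subst c d fps_X = fps_const c * fps_X ^ d"
  by (simp add: fps_subst_def)

lemma fps_subst_scale: "d > 0 \<Longrightarrow> fps_subst c d (fps_subst r 1 f) = fps_subst (c * r) d f"
  by (rule fps_ext) (auto simp: fps_nth_subst power_mult_distrib)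

lemma fps_scale_subst: "d > 0 \<Longrightarrow> fps_subst r 1 (fps_subst c d f) = fps_subst (c * r ^ d) d f"
  by (rule fps_ext) (auto simp: fps_nth_subst power_mult_distrib simp flip: power_mult)

section \<open>Double sums with Gaussian weights\<close>

lemma summable_bounded:
  fixes f :: "nat \<Rightarrow> 'a :: real_normed_vector"
  assumes "summable f"
  obtains K where "K > 0" "\<And>n. norm (f n) \<le> K"
  using BseqE[OF convergent_imp_Bseq[OF convergentI[OF summable_LIMSEQ_zero[OF assms]]]] by metis

text \<open>
  Against Gaussian weights \<open>q\<^bsup>n(n+1)/2\<^esup>\<close> every geometrically bounded coefficient sequence is
  summable. Such sequences are the power series of positive radius of convergence, a class that is
  closed under all operations used below.
\<close>
lemma fps_conv_radius_pos_iff: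
  "fps_conv_radius (f :: complex fps) > 0 \<longleftrightarrow> (\<exists>C r. \<forall>n. norm (fps_nth f n) \<le> C * r ^ n)"
proof
  assume "fps_conv_radius f > 0"
  then obtain z where z: "z > 0" "ereal z < fps_conv_radius f"
    using ereal_dense2[of 0 "fps_conv_radius f"] by auto
  have "summable (\<lambda>n. fps_nth f n * complex_of_real z ^ n)"
    by (rule summable_in_conv_radius) (use z in \<open>simp add: fps_conv_radius_def\<close>)
  then obtain C where "C > 0" and C: "\<And>n. norm (fps_nth f n * complex_of_real z ^ n) \<le> C"
    using summable_bounded by blast
  have "norm (fps_nth f n) \<le> C * (1 / z) ^ n" for n
    using C[of n] z by (simp add: norm_mult norm_power power_divide field_simps)
  thus "\<exists>C r. \<forall>n. norm (fps_nth f n) \<le> C * r ^ n" by blast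
next
  assume "\<exists>C r. \<forall>n. norm (fps_nth f n) \<le> C * r ^ n"
  then obtain C r where Cr: "\<And>n. norm (fps_nth f n) \<le> C * r ^ n" by blast
  define R where "R = \<bar>r\<bar> + 1"
  have R: "R > 0" by (simp add: R_def)
  have C0: "C \<ge> 0" using order.trans[OF norm_ge_zero Cr[of 0]] by simp
  have "norm (fps_nth f n) \<le> C * R ^ n" for n
  proof -
    have "C * r ^ n \<le> C * \<bar>r\<bar> ^ n" using C0 by (intro mult_left_mono) (metis abs_ge_self power_abs)
    also have "\<dots> \<le> C * R ^ n" using C0 by (intro mult_left_mono power_mono) (auto simp: R_def)
    finally show ?thesis using Cr[of n] by linarith
  qed
  hence bound: "norm (fps_nth f n * complex_of_real (1 / (2 * R)) ^ n) \<le> C * (1 / 2) ^ n" for n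
    using R by (simp add: norm_mult norm_power norm_divide power_divide power_mult_distrib field_simps)
  have "summable (\<lambda>n. C * (1 / 2 :: real) ^ n)"
    by (intro summable_mult summable_geometric) simp
  hence "summable (\<lambda>n. fps_nth f n * complex_of_real (1 / (2 * R)) ^ n)"
    by (rule summable_comparison_test'[where N = 0]) (rule bound)
  hence "ereal (norm (complex_of_real (1 / (2 * R)))) \<le> fps_conv_radius f"
    unfolding fps_conv_radius_def by (rule conv_radius_geI)
  moreover have "0 < ereal (norm (complex_of_real (1 / (2 * R))))" using R by simp
  ultimately show "fps_conv_radius f > 0" by (rule less_le_trans[rotated])
qed

lemma fps_conv_radius_pos_E:
  assumes "fps_conv_radius (f :: complex fps) > 0"
  obtains C r where "C > 0" "r \<ge> 1" "\<And>n. norm (fps_nth f n) \<le> C * r ^ n"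
proof -
  obtain C r where Cr: "\<And>n. norm (fps_nth f n) \<le> C * r ^ n"
    using assms fps_conv_radius_pos_iff by blast
  have "norm (fps_nth f n) \<le> (\<bar>C\<bar> + 1) * (\<bar>r\<bar> + 1) ^ n" for n
  proof -
    have "C * r ^ n \<le> \<bar>C\<bar> * \<bar>r\<bar> ^ n" by (metis abs_ge_self abs_mult power_abs)
    also have "\<dots> \<le> (\<bar>C\<bar> + 1) * (\<bar>r\<bar> + 1) ^ n" by (intro mult_mono power_mono) auto
    finally show ?thesis using Cr[of n] by linarith
  qed
  thus ?thesis by (intro that[of "\<bar>C\<bar> + 1" "\<bar>r\<bar> + 1"]) auto
qed

lemma fps_conv_radius_mult_pos:
  "fps_conv_radius (f :: complex fps) > 0 \<Longrightarrow> fps_conv_radius g > 0 \<Longrightarrow> fps_conv_radius (f * g) > 0"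
  using fps_conv_radius_mult[of f g] by (auto simp: min_def split: if_splits)

lemma fps_conv_radius_subst_pos:
  assumes "fps_conv_radius f > 0" "d > 0"
  shows "fps_conv_radius (fps_subst c d f) > 0"
proof -
  obtain C r where Cr: "C > 0" "r \<ge> 1" "\<And>n. norm (fps_nth f n) \<le> C * r ^ n"
    using fps_conv_radius_pos_E[OF assms(1)] by blast
  define R where "R = r * (norm c + 1)"
  have R: "R \<ge> 1" "0 \<le> r" unfolding R_def using Cr(2) using mult_mono[of 1 r 1 "norm c + 1"] by auto
  have "norm (fps_nth (fps_subst c d f) n) \<le> C * R ^ n" for n
  proof (cases "d dvd n")
    case True
    have "norm (fps_nth (fps_subst c d f) n) = norm (fps_nth f (n div d)) * norm c ^ (n div d)"
      using True assms(2) by (simp add: fps_nth_subst norm_mult norm_power)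
    also have "\<dots> \<le> (C * r ^ (n div d)) * (norm c + 1) ^ (n div d)"
      using Cr by (intro mult_mono power_mono) auto
    also have "\<dots> = C * R ^ (n div d)" by (simp add: R_def power_mult_distrib)
    also have "\<dots> \<le> C * R ^ n"
      using Cr(1) R by (intro mult_left_mono power_increasing) auto
    finally show ?thesis .
  next
    case False
    thus ?thesis using assms(2) Cr R by (simp add: fps_nth_subst)
  qed
  thus ?thesis using fps_conv_radius_pos_iff by blast
qed

text \<open>
  The ratio of consecutive terms of \<open>x\<^bsup>n(n+1)/2\<^esup> (2 r)\<^sup>n\<close> tends to \<open>0\<close>, so these terms are bounded.
\<close>
lemma gaussian_dominates_geometric:
  fixes x r :: real
  assumes "0 \<le> x" "x < 1" "r \<ge> 0"
  obtains K where "K > 0" "\<And>n. x ^ (Suc n choose 2) * r ^ n \<le> K * (1 / 2) ^ n"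
proof -
  define y where "y n = x ^ (Suc n choose 2) * (2 * r) ^ n" for n
  have "(\<lambda>n. x ^ n) \<longlonglongrightarrow> 0"
    using assms by (simp add: LIMSEQ_power_zero)
  hence "(\<lambda>n. x ^ Suc n * (2 * r)) \<longlonglongrightarrow> 0"
    by (rule tendsto_mult_left_zero[OF LIMSEQ_Suc])
  hence "eventually (\<lambda>n. x ^ Suc n * (2 * r) < 1/2) sequentially"
    by (rule order_tendstoD(2)) simp
  then obtain N where N: "\<And>n. n \<ge> N \<Longrightarrow> x ^ Suc n * (2 * r) < 1/2"
    by (auto simp: eventually_sequentially)
  have "summable y"
  proof (rule summable_ratio_test[of "1/2" N])
    fix n assume n: "n \<ge> N"
    have "y (Suc n) = (x ^ Suc n * (2 * r)) * y n"
      by (simp add: y_def choose_two_Suc[of "Suc n"] power_add mult_ac)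
    moreover have "0 \<le> x ^ Suc n * (2 * r)" using assms by auto
    ultimately have "norm (y (Suc n)) = (x ^ Suc n * (2 * r)) * norm (y n)"
      by (metis abs_mult abs_of_nonneg real_norm_def)
    thus "norm (y (Suc n)) \<le> 1/2 * norm (y n)"
      using mult_right_mono[OF less_imp_le[OF N[OF n]], of "norm (y n)"] by simp
  qed auto
  then obtain K where K: "K > 0" "\<And>n. norm (y n) \<le> K"
    using summable_bounded by blast
  have "x ^ (Suc n choose 2) * r ^ n \<le> K * (1 / 2) ^ n" for n
    using K(2)[of n] by (simp add: y_def power_mult_distrib power_divide field_simps)
  thus ?thesis using K(1) that by blast
qed

lemma has_sum_antidiagonal:
  fixes F :: "nat \<times> nat \<Rightarrow> complex"
  assumes "(F has_sum S) UNIV"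
  shows "((\<lambda>n. \<Sum>i\<le>n. F (i, n - i)) has_sum S) UNIV"
proof -
  have "((\<lambda>(n, i). F (i, n - i)) has_sum S) (SIGMA n:UNIV. {..n}) = (F has_sum S) UNIV"
    by (rule has_sum_reindex_bij_witness[where j = "\<lambda>(n, i). (i, n - i)" and i = "\<lambda>(i, j). (i + j, i)"]) auto
  hence "((\<lambda>(n, i). F (i, n - i)) has_sum S) (SIGMA n:UNIV. {..n})" using assms by simp
  thus ?thesis by (rule has_sum_SigmaD) (auto intro: has_sum_finite)
qed

lemma has_sum_imp_suminf: "(f has_sum S) UNIV \<Longrightarrow> suminf f = S" for f :: "nat \<Rightarrow> complex"
  by (drule has_sum_imp_sums) (rule sums_unique[symmetric])

text \<open>
  The one rearrangement principle behind all series manipulations. Since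
  \<open>r\<^sup>i r\<^sup>j = r\<^bsup>i+j\<^esup>\<close> is absorbed by the Gaussian weight up to a factor \<open>2\<^bsup>-(i+j)\<^esup>\<close>, the double series is
  dominated by a product of two geometric series, and summing it along antidiagonals gives the
  Cauchy product.
\<close>
lemma gaussian_double_sum:
  fixes q :: complex and f g :: "complex fps" and \<Omega> :: "nat \<Rightarrow> complex"
  assumes q: "norm q < 1" and \<Omega>: "\<And>n. norm (\<Omega> n) \<le> M * norm q ^ (Suc n choose 2)"
    and f: "fps_conv_radius f > 0" and g: "fps_conv_radius g > 0"
  shows "((\<lambda>(i, j). fps_nth f i * fps_nth g j * \<Omega> (i + j)) has_sum (\<Sum>n. fps_nth (f * g) n * \<Omega> n)) UNIV"
proof -
  obtain C r where f: "C > 0" "r \<ge> 1" "\<And>n. norm (fps_nth f n) \<le> C * r ^ n"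
    using fps_conv_radius_pos_E[OF f] by blast
  obtain C' r' where g: "C' > 0" "r' \<ge> 1" "\<And>n. norm (fps_nth g n) \<le> C' * r' ^ n"
    using fps_conv_radius_pos_E[OF g] by blast
  define R where "R = max r r'"
  have R: "R \<ge> 0" "r \<le> R" "r' \<le> R" using f(2) by (auto simp: R_def)
  obtain K where K: "K > 0" "\<And>n. norm q ^ (Suc n choose 2) * R ^ n \<le> K * (1 / 2) ^ n"
    using gaussian_dominates_geometric[of "norm q" R] q R by auto
  have M: "M \<ge> 0" using order.trans[OF norm_ge_zero \<Omega>[of 0]] by (simp add: numeral_2_eq_2)
  let ?F = "\<lambda>(i, j). fps_nth f i * fps_nth g j * \<Omega> (i + j)"
  define B where "B = C * C' * M * K"
  define G :: "nat \<times> nat \<Rightarrow> real" where "G = (\<lambda>(i, j). B * (1 / 2) ^ i * (1 / 2) ^ j)"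
  have bound: "norm (?F p) \<le> G p" for p
  proof (cases p)
    case (Pair i j)
    have "norm (?F p) = norm (fps_nth f i) * norm (fps_nth g j) * norm (\<Omega> (i + j))"
      by (simp add: Pair norm_mult)
    also have "\<dots> \<le> (C * R ^ i) * (C' * R ^ j) * (M * norm q ^ (Suc (i + j) choose 2))"
    proof (intro mult_mono \<Omega>)
      show "norm (fps_nth f i) \<le> C * R ^ i"
        using f R by (intro order.trans[OF f(3)] mult_left_mono power_mono) auto
      show "norm (fps_nth g j) \<le> C' * R ^ j"
        using g R by (intro order.trans[OF g(3)] mult_left_mono power_mono) auto
    qed (use f g R in auto)
    also have "\<dots> = C * C' * M * (norm q ^ (Suc (i + j) choose 2) * R ^ (i + j))"
      by (simp add: power_add mult_ac)
    also have "\<dots> \<le> C * C' * M * (K * (1 / 2) ^ (i + j))"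
      using f(1) g(1) M by (intro mult_left_mono K) auto
    finally show ?thesis by (simp add: Pair G_def B_def power_add mult_ac)
  qed
  have geo: "((\<lambda>i. (1 / 2 :: real) ^ i) has_sum 2) UNIV"
    by (rule norm_summable_imp_has_sum) (use geometric_sums[of "1/2 :: real"] in \<open>auto intro: summable_geometric\<close>)
  have "G summable_on (UNIV \<times> UNIV)"
  proof (rule summable_on_SigmaI)
    show "((\<lambda>j. G (i, j)) has_sum (B * (1/2) ^ i * 2)) UNIV" for i
      using has_sum_cmult_right[OF geo, of "B * (1/2) ^ i"] by (simp add: G_def)
    have "((\<lambda>i. B * (1/2) ^ i * 2) has_sum B * 2 * 2) UNIV"
      using has_sum_cmult_right[OF geo, of "B * 2"] by (simp add: mult_ac)
    thus "(\<lambda>i. B * (1/2) ^ i * 2) summable_on (UNIV :: nat set)"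
      by (auto simp: summable_on_def)
  qed (use f g M K in \<open>auto simp: G_def B_def\<close>)
  hence "G summable_on UNIV" by simp
  hence "(\<lambda>p. norm (?F p)) summable_on UNIV"
    by (rule Infinite_Sum.abs_summable_on_comparison_test') (rule bound)
  hence "?F summable_on UNIV" by (rule abs_summable_summable)
  then obtain S where S: "(?F has_sum S) UNIV" by (auto simp: summable_on_def)
  have "((\<lambda>n. \<Sum>i\<le>n. ?F (i, n - i)) has_sum S) UNIV" by (rule has_sum_antidiagonal[OF S])
  also have "(\<lambda>n. \<Sum>i\<le>n. ?F (i, n - i)) = (\<lambda>n. fps_nth (f * g) n * \<Omega> n)"
    by (auto simp: fps_mult_nth sum_distrib_right atLeast0AtMost intro!: sum.cong)
  finally have "(\<Sum>n. fps_nth (f * g) n * \<Omega> n) = S" by (rule has_sum_imp_suminf)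
  thus ?thesis using S by simp
qed

section \<open>Euler's two q-exponential series\<close>

text \<open>
  The expansions of \<open>(w;p)\<^sub>\<infinity>\<close> and of \<open>1/(w;p)\<^sub>\<infinity>\<close> in powers of \<open>w\<close>. Most of the argument uses only
  their q-difference equations; that the first series really sums to the infinite product is needed
  for the closed form at the end.
\<close>
definition qpoch_fps :: "complex \<Rightarrow> complex fps" where
  "qpoch_fps p = Abs_fps (\<lambda>k. (-1) ^ k * p ^ (k choose 2) / qpoch p p k)"

definition inv_qpoch_fps :: "complex \<Rightarrow> complex fps" where
  "inv_qpoch_fps p = Abs_fps (\<lambda>k. 1 / qpoch p p k)"

lemma qpoch_fps_functional:
  assumes p: "norm p < 1"
  shows "qpoch_fps p = (1 - fps_X) * fps_subst p 1 (qpoch_fps p)"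
proof (rule fps_ext)
  fix n
  show "fps_nth (qpoch_fps p) n = fps_nth ((1 - fps_X) * fps_subst p 1 (qpoch_fps p)) n"
  proof (cases n)
    case 0
    thus ?thesis by (simp add: qpoch_fps_def fps_nth_subst)
  next
    case (Suc k)
    have nz: "qpoch p p k \<noteq> 0" "1 - p * p ^ k \<noteq> 0"
      using qpoch_nonzero[OF p p] one_minus_power_nonzero[OF p p] by auto
    have "fps_nth ((1 - fps_X) * fps_subst p 1 (qpoch_fps p)) n
        = fps_nth (qpoch_fps p) (Suc k) * p ^ Suc k - fps_nth (qpoch_fps p) k * p ^ k"
      by (simp add: Suc left_diff_distrib fps_nth_subst)
    also have "\<dots> = fps_nth (qpoch_fps p) (Suc k)"
      using nz by (simp add: qpoch_fps_def qpoch_Suc choose_two_Suc power_add divide_simps) (simp add: algebra_simps)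
    finally show ?thesis by (simp add: Suc)
  qed
qed

lemma inv_qpoch_fps_functional:
  assumes p: "norm p < 1"
  shows "fps_subst p 1 (inv_qpoch_fps p) = (1 - fps_X) * inv_qpoch_fps p"
proof (rule fps_ext)
  fix n
  show "fps_nth (fps_subst p 1 (inv_qpoch_fps p)) n = fps_nth ((1 - fps_X) * inv_qpoch_fps p) n"
  proof (cases n)
    case 0
    thus ?thesis by (simp add: inv_qpoch_fps_def fps_nth_subst)
  next
    case (Suc k)
    have nz: "qpoch p p k \<noteq> 0" "1 - p * p ^ k \<noteq> 0"
      using qpoch_nonzero[OF p p] one_minus_power_nonzero[OF p p] by auto
    thus ?thesis
      by (simp add: Suc left_diff_distrib fps_nth_subst inv_qpoch_fps_def qpoch_Suc divide_simps)
         (simp add: algebra_simps)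
  qed
qed

lemma subst_qpoch_fps:
  assumes "norm p < 1" "d > 0"
  shows "fps_subst c d (qpoch_fps p) = (1 - fps_const c * fps_X ^ d) * fps_subst (c * p) d (qpoch_fps p)"
  by (subst qpoch_fps_functional[OF assms(1)])
     (simp add: fps_subst_mult fps_subst_diff fps_subst_X fps_subst_scale assms del: One_nat_def)

lemma subst_inv_qpoch_fps:
  assumes "norm p < 1" "d > 0"
  shows "fps_subst (c * p) d (inv_qpoch_fps p) = (1 - fps_const c * fps_X ^ d) * fps_subst c d (inv_qpoch_fps p)"
  using arg_cong[OF inv_qpoch_fps_functional[OF assms(1)], of "fps_subst c d"]
  by (simp add: fps_subst_mult fps_subst_diff fps_subst_X fps_subst_scale assms del: One_nat_def)

lemma fps_conv_radius_inv_qpoch_fps: 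
  assumes "norm p < 1"
  shows "fps_conv_radius (inv_qpoch_fps p) > 0"
proof -
  obtain M where "M > 0" "\<And>n. norm (1 / qpoch p p n) \<le> M"
    using inverse_qpoch_bounded[OF assms assms] by blast
  hence "\<forall>n. norm (fps_nth (inv_qpoch_fps p) n) \<le> M * 1 ^ n" by (simp add: inv_qpoch_fps_def)
  thus ?thesis using fps_conv_radius_pos_iff by blast
qed

lemma norm_qpoch_fps_le: 
  assumes "norm p < 1"
  shows "norm (fps_nth (qpoch_fps p) n) \<le> norm (fps_nth (inv_qpoch_fps p) n) * norm p ^ (n choose 2)"
  by (simp add: qpoch_fps_def inv_qpoch_fps_def norm_mult norm_divide norm_power)

lemma fps_conv_radius_qpoch_fps: 
  assumes "norm p < 1"
  shows "fps_conv_radius (qpoch_fps p) > 0"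
proof -
  obtain C r where "\<And>n. norm (fps_nth (inv_qpoch_fps p) n) \<le> C * r ^ n"
    using fps_conv_radius_pos_iff fps_conv_radius_inv_qpoch_fps[OF assms] by blast
  moreover have "norm (fps_nth (qpoch_fps p) n) \<le> norm (fps_nth (inv_qpoch_fps p) n) * 1" for n
    using assms by (intro order.trans[OF norm_qpoch_fps_le] mult_left_mono power_le_one) auto
  ultimately have "\<forall>n. norm (fps_nth (qpoch_fps p) n) \<le> C * r ^ n"
    by (metis mult.right_neutral order.trans)
  thus ?thesis using fps_conv_radius_pos_iff by blast
qed

text \<open>
  By the two q-difference equations the product of the two series is invariant under
  \<open>w \<mapsto> p w\<close>. An invariant power series is constant because \<open>p\<^sup>n \<noteq> 1\<close> for \<open>n > 0\<close>.
\<close>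
lemma inv_qpoch_fps_subst_inverse:
  assumes p: "norm p < 1" "d > 0"
  shows "fps_subst c d (inv_qpoch_fps p) * fps_subst c d (qpoch_fps p) = 1"
proof -
  define P where "P = inv_qpoch_fps p * qpoch_fps p"
  have "(1 - fps_X) * fps_subst p 1 P = fps_subst p 1 (inv_qpoch_fps p) * ((1 - fps_X) * fps_subst p 1 (qpoch_fps p))"
    by (simp add: P_def fps_subst_mult mult_ac)
  also have "\<dots> = (1 - fps_X) * P"
    by (simp only: qpoch_fps_functional[OF p(1), symmetric] inv_qpoch_fps_functional[OF p(1)] P_def mult.assoc)
  finally have "(1 - fps_X) * fps_subst p 1 P = (1 - fps_X) * P" .
  moreover have "(1 - fps_X :: complex fps) \<noteq> 0"
    using arg_cong[of "1 - fps_X :: complex fps" 0 "\<lambda>f. fps_nth f 0"] by auto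
  ultimately have P: "fps_subst p 1 P = P" by simp
  have "P = 1"
  proof (rule fps_ext)
    fix n
    show "fps_nth P n = fps_nth 1 n"
    proof (cases n)
      case 0
      thus ?thesis by (simp add: P_def inv_qpoch_fps_def qpoch_fps_def)
    next
      case (Suc k)
      have "fps_nth P n * p ^ n = fps_nth P n"
        using arg_cong[OF P, of "\<lambda>f. fps_nth f n"] by (simp add: fps_nth_subst)
      hence "fps_nth P n * (1 - p * p ^ k) = 0" by (simp add: Suc algebra_simps)
      thus ?thesis using one_minus_power_nonzero[OF p(1) p(1)] by (simp add: Suc)
    qed
  qed
  thus ?thesis using p by (simp add: P_def flip: fps_subst_mult)
qed

text \<open>
  The sum \<open>\<Phi>\<close> of the series satisfies \<open>\<Phi>(w) = (1 - w) \<Phi>(w p)\<close>. Iterating this extracts the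
  partial products of \<open>(w;p)\<^sub>\<infinity>\<close> and moves the argument to \<open>0\<close>, where \<open>\<Phi>\<close> is continuous with
  value \<open>1\<close>.
\<close>
lemma euler_product_sums:
  fixes p w :: complex
  assumes p: "norm p < 1"
  shows "(\<lambda>k. (-1) ^ k * p ^ (k choose 2) * w ^ k / qpoch p p k) sums qpoch_inf w p"
proof -
  define a where "a = fps_nth (qpoch_fps p)"
  obtain M where M: "M > 0" "\<And>n. norm (1 / qpoch p p n) \<le> M"
    using inverse_qpoch_bounded[OF p p] by blast
  have summ: "summable (\<lambda>k. a k * w ^ k)" for w
  proof -
    obtain K where K: "K > 0" "\<And>n. norm p ^ (Suc n choose 2) * norm w ^ n \<le> K * (1 / 2) ^ n"
      using gaussian_dominates_geometric[of "norm p" "norm w"] p by auto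
    have bound: "norm (a (Suc n) * w ^ Suc n) \<le> M * norm w * K * (1/2) ^ n" for n
    proof -
      have "norm (a (Suc n) * w ^ Suc n) = norm (1 / qpoch p p (Suc n)) * norm w * (norm p ^ (Suc n choose 2) * norm w ^ n)"
        by (simp add: a_def qpoch_fps_def norm_mult norm_divide norm_power)
      also have "\<dots> \<le> M * norm w * (K * (1/2) ^ n)"
        using M(1) p by (intro mult_mono M K) auto
      finally show ?thesis by simp
    qed
    have "summable (\<lambda>n. M * norm w * K * (1 / 2 :: real) ^ n)"
      by (intro summable_mult summable_geometric) simp
    hence "summable (\<lambda>n. a (Suc n) * w ^ Suc n)"
      by (rule summable_comparison_test'[where N = 0]) (rule bound)
    thus ?thesis using summable_Suc_iff[of "\<lambda>n. a n * w ^ n"] by blast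
  qed
  define \<Phi> where "\<Phi> w = (\<Sum>k. a k * w ^ k)" for w
  have step: "\<Phi> w = (1 - w) * \<Phi> (w * p)" for w
  proof -
    have rec: "a (Suc k) = a (Suc k) * p ^ Suc k - a k * p ^ k" for k
      using arg_cong[OF qpoch_fps_functional[OF p], of "\<lambda>f. fps_nth f (Suc k)"]
      by (simp add: a_def left_diff_distrib fps_nth_subst)
    have s1: "summable (\<lambda>k. a (Suc k) * (w * p) ^ Suc k)" using summ[of "w * p"] summable_Suc_iff[of "\<lambda>k. a k * (w * p) ^ k"] by blast
    have "\<Phi> w = a 0 + (\<Sum>k. a (Suc k) * w ^ Suc k)"
      unfolding \<Phi>_def using suminf_split_head[OF summ[of w]] by simp
    also have "(\<lambda>k. a (Suc k) * w ^ Suc k) = (\<lambda>k. a (Suc k) * (w * p) ^ Suc k - w * (a k * (w * p) ^ k))"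
      by (rule ext, subst rec) (simp add: power_mult_distrib algebra_simps)
    also have "(\<Sum>k. \<dots> k) = (\<Sum>k. a (Suc k) * (w * p) ^ Suc k) - w * \<Phi> (w * p)"
      unfolding \<Phi>_def using s1 summ[of "w * p"] by (subst suminf_diff [symmetric]) (auto simp: suminf_mult intro: summable_mult)
    also have "a 0 + \<dots> = \<Phi> (w * p) - w * \<Phi> (w * p)"
      unfolding \<Phi>_def using suminf_split_head[OF summ[of "w * p"]] by simp
    finally show ?thesis by (simp add: algebra_simps)
  qed
  have iter: "\<Phi> w = qpoch w p n * \<Phi> (w * p ^ n)" for n
    by (induction n) (auto simp: qpoch_Suc step[of "w * p ^ _"] mult_ac)
  have "isCont \<Phi> 0"
    unfolding \<Phi>_def by (rule isCont_powser[of _ 1]) (use summ[of 1] in auto)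
  moreover have "(\<lambda>n. w * p ^ n) \<longlonglongrightarrow> w * 0"
    using p by (intro tendsto_mult tendsto_const LIMSEQ_power_zero) auto
  ultimately have "(\<lambda>n. \<Phi> (w * p ^ n)) \<longlonglongrightarrow> \<Phi> 0"
    using isCont_tendsto_compose[of 0 \<Phi> "\<lambda>n. w * p ^ n" sequentially] by simp
  hence "(\<lambda>n. qpoch w p n * \<Phi> (w * p ^ n)) \<longlonglongrightarrow> qpoch_inf w p * \<Phi> 0"
    by (intro tendsto_mult qpoch_tendsto p)
  moreover have "\<Phi> 0 = a 0" unfolding \<Phi>_def by (rule powser_zero)
  moreover have "a 0 = 1" by (simp add: a_def qpoch_fps_def)
  ultimately have "\<Phi> w = qpoch_inf w p"
    by (simp flip: iter add: LIMSEQ_const_iff)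
  thus ?thesis using summ[of w] by (simp add: \<Phi>_def a_def qpoch_fps_def sums_iff)
qed

section \<open>The Gaussian functional\<close>

text \<open>
  The sum \<open>\<Sum> (-1)\<^sup>n q\<^bsup>n(n+1)/2\<^esup> f\<^sub>n\<close> is, up to the substitution \<open>z \<mapsto> -1/z\<close> in the theta series,
  the constant term of the product of \<open>f\<close> with a theta function. The quasi-periodicity of the theta
  function becomes \<open>gauss_sum_shift_zero\<close> below.
\<close>
definition gauss_weight :: "complex \<Rightarrow> nat \<Rightarrow> complex" where
  "gauss_weight q n = (-1) ^ n * q ^ (Suc n choose 2)"

definition gauss_sum :: "complex \<Rightarrow> complex fps \<Rightarrow> complex" where
  "gauss_sum q f = (\<Sum>n. fps_nth f n * gauss_weight q n)"

lemma gauss_weight_0 [simp]: "gauss_weight q 0 = 1"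
  by (simp add: gauss_weight_def numeral_2_eq_2)

lemma norm_gauss_weight: "norm (gauss_weight q n) = norm q ^ (Suc n choose 2)"
  by (simp add: gauss_weight_def norm_mult norm_power)

lemma gauss_weight_Suc: "gauss_weight q (Suc n) = - (q ^ Suc n * gauss_weight q n)"
  by (simp add: gauss_weight_def choose_two_Suc[of "Suc n"] power_add)

lemma gauss_weight_add: "gauss_weight q (n + s) = gauss_weight q n * gauss_weight q s * q ^ (n * s)"
  using choose_two_add[of "Suc n" s]
  by (simp add: gauss_weight_def power_add choose_two_Suc[of s] mult_ac)

lemma gaussian_norm_summable:
  fixes f :: "complex fps" and q :: complex
  assumes q: "norm q < 1" and f: "fps_conv_radius f > 0"
  shows "summable (\<lambda>n. norm (fps_nth f n) * norm q ^ (Suc n choose 2))"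
proof -
  obtain C r where f: "C > 0" "r \<ge> 1" "\<And>n. norm (fps_nth f n) \<le> C * r ^ n"
    using fps_conv_radius_pos_E[OF f] by blast
  obtain K where K: "K > 0" "\<And>n. norm q ^ (Suc n choose 2) * r ^ n \<le> K * (1 / 2) ^ n"
    using gaussian_dominates_geometric[of "norm q" r] q f by auto
  have bound: "norm (norm (fps_nth f n) * norm q ^ (Suc n choose 2)) \<le> C * K * (1/2) ^ n" for n
  proof -
    have "norm (fps_nth f n) * norm q ^ (Suc n choose 2) \<le> (C * r ^ n) * norm q ^ (Suc n choose 2)"
      by (intro mult_right_mono f(3)) auto
    also have "\<dots> = C * (norm q ^ (Suc n choose 2) * r ^ n)" by simp
    also have "\<dots> \<le> C * (K * (1/2) ^ n)" using f(1) by (intro mult_left_mono K) auto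
    finally show ?thesis by simp
  qed
  have "summable (\<lambda>n. C * K * (1 / 2 :: real) ^ n)"
    by (intro summable_mult summable_geometric) simp
  thus ?thesis by (rule summable_comparison_test'[where N = 0]) (rule bound)
qed

lemma gauss_summable:
  assumes q: "norm q < 1" and f: "fps_conv_radius f > 0"
  shows "summable (\<lambda>n. fps_nth f n * gauss_weight q n)"
  by (rule summable_norm_cancel) (simp add: norm_mult norm_gauss_weight gaussian_norm_summable assms)

lemma gauss_sum_diff:
  assumes "norm q < 1" "fps_conv_radius f > 0" "fps_conv_radius g > 0"
  shows "gauss_sum q (f - g) = gauss_sum q f - gauss_sum q g"
  using suminf_diff[OF gauss_summable gauss_summable] assms
  by (simp add: gauss_sum_def left_diff_distrib)

lemma gauss_sum_const_mult:
  assumes "norm q < 1" "fps_conv_radius f > 0"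
  shows "gauss_sum q (fps_const a * f) = a * gauss_sum q f"
  using suminf_mult[OF gauss_summable[OF assms], of a]
  by (simp add: gauss_sum_def mult.assoc)

text \<open>
  Multiplying by \<open>z\<close> moves the coefficient \<open>g\<^sub>n\<close> to the weight of index \<open>n + 1\<close>, which is
  \<open>-q\<^bsup>n+1\<^esup>\<close> times the weight of index \<open>n\<close>; the other summand gives \<open>g\<^sub>n\<close> the factor \<open>q\<^bsup>n+1\<^esup>\<close>.
  So the functional annihilates these expressions, which are the discrete analogue of exact
  derivatives. All identities for the deformed sum come from them.
\<close>
lemma gauss_sum_shift_zero:
  assumes q: "norm q < 1" and g: "fps_conv_radius g > 0"
  shows "gauss_sum q (fps_const q * fps_subst q 1 g + fps_X * g) = 0"
proof -
  have r: "fps_conv_radius (fps_subst q 1 g) > 0" by (rule fps_conv_radius_subst_pos[OF g]) simp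
  have r': "fps_conv_radius (fps_X * g) > 0" by (rule fps_conv_radius_mult_pos) (use g in auto)
  have "gauss_sum q (fps_const q * fps_subst q 1 g + fps_X * g)
      = (\<Sum>n. q * (fps_nth (fps_subst q 1 g) n * gauss_weight q n)) + (\<Sum>n. fps_nth (fps_X * g) n * gauss_weight q n)"
    unfolding gauss_sum_def
    by (subst suminf_add) (use gauss_summable[OF q r] gauss_summable[OF q r'] in \<open>auto simp: algebra_simps summable_mult\<close>)
  also have "(\<Sum>n. fps_nth (fps_X * g) n * gauss_weight q n) = (\<Sum>n. fps_nth (fps_X * g) (Suc n) * gauss_weight q (Suc n))"
    using suminf_split_head[OF gauss_summable[OF q r']] by simp
  also have "\<dots> = (\<Sum>n. - (q * (fps_nth (fps_subst q 1 g) n * gauss_weight q n)))"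
    by (simp add: gauss_weight_Suc fps_nth_subst mult_ac)
  also have "\<dots> = - (\<Sum>n. q * (fps_nth (fps_subst q 1 g) n * gauss_weight q n))"
    by (intro suminf_minus summable_mult gauss_summable q r)
  finally show ?thesis by simp
qed

section \<open>A one-parameter deformation of the double sum\<close>

text \<open>
  The series \<open>(q z;q)\<^sub>\<infinity> / (q z\<^sup>2;q\<^sup>2)\<^sub>\<infinity>\<close>.
\<close>
definition base_factor :: "complex \<Rightarrow> complex fps" where
  "base_factor q = fps_subst q 1 (qpoch_fps q) * fps_subst q 2 (inv_qpoch_fps (q^2))"

text \<open>
  The series \<open>(c z\<^sup>2;q\<^sup>2)\<^sub>\<infinity> / (c z\<^sup>3;q\<^sup>3)\<^sub>\<infinity>\<close>. At \<open>c = q\<close> its numerator cancels the denominator of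
  the base factor, and what remains is the generating function of the double sum to be evaluated.
\<close>
definition param_factor :: "complex \<Rightarrow> complex \<Rightarrow> complex fps" where
  "param_factor q c = fps_subst c 3 (inv_qpoch_fps (q^3)) * fps_subst c 2 (qpoch_fps (q^2))"

definition deformed_sum :: "complex \<Rightarrow> complex \<Rightarrow> complex" where
  "deformed_sum q c = gauss_sum q (param_factor q c * base_factor q)"

lemma norm_power_less_one: "norm (q :: complex) < 1 \<Longrightarrow> n > 0 \<Longrightarrow> norm (q ^ n) < 1"
  by (simp add: norm_power power_less_one_iff)

lemma conv_radius_factors:
  assumes "norm q < 1"
  shows "fps_conv_radius (base_factor q) > 0" "fps_conv_radius (param_factor q c) > 0"
  unfolding base_factor_def param_factor_def using assms
  by (auto intro!: fps_conv_radius_mult_pos fps_conv_radius_subst_pos fps_conv_radius_qpoch_fps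
      fps_conv_radius_inv_qpoch_fps norm_power_less_one)

lemma base_factor_functional:
  assumes q: "norm q < 1"
  shows "(1 - fps_const q * fps_X) * fps_subst q 1 (base_factor q) = (1 - fps_const q * fps_X ^ 2) * base_factor q"
proof -
  have q2: "norm (q^2) < 1" using q by (simp add: norm_power_less_one)
  have "(1 - fps_const q * fps_X) * fps_subst q 1 (base_factor q)
      = ((1 - fps_const q * fps_X ^ 1) * fps_subst (q * q) 1 (qpoch_fps q)) * fps_subst (q * q^2) 2 (inv_qpoch_fps (q^2))"
    by (simp add: base_factor_def fps_subst_mult fps_scale_subst mult.assoc del: One_nat_def)
  also have "\<dots> = fps_subst q 1 (qpoch_fps q) * ((1 - fps_const q * fps_X ^ 2) * fps_subst q 2 (inv_qpoch_fps (q^2)))"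
    by (subst subst_qpoch_fps[OF q, symmetric], simp, subst subst_inv_qpoch_fps[OF q2], simp_all)
  finally show ?thesis by (simp add: base_factor_def mult_ac)
qed

text \<open>
  The certificate for the functional equation in \<open>c\<close>. All infinite products that occur there are
  polynomial multiples of a common series, and this is the resulting identity between the polynomial
  multipliers. The factors \<open>1 - x\<close> and \<open>1 - c q\<^sup>4 x\<^sup>2\<close> on the right are those that clear the
  denominators produced by \<open>x \<mapsto> q x\<close>; the remaining linear factor \<open>c (q\<^sup>2 - x)\<close> is then
  determined by comparing coefficients.
\<close>
lemma telescoping_polynomial:
  fixes c q x :: "'a :: comm_ring_1"
  shows "(1 - c * x^2) * (1 - c * q^2 * x^2) * (1 - c * q^4 * x^2) - (1 - c * q^3) * (1 - c * q^3 * x^3) * (1 - c * x^3)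
    = q * (c * (q^2 - q * x) * (1 - q * x^2) * (1 - c * x^3)) + x * (c * (1 - x) * (q^2 - x) * (1 - c * q^4 * x^2))"
  by (simp add: eval_nat_numeral algebra_simps)

text \<open>
  The difference of the series for \<open>c\<close> and \<open>1 - c q\<^sup>3\<close> times the series for \<open>c q\<^sup>6\<close> is of the form
  \<open>q g(q z) + z g(z)\<close>, hence is annihilated by the Gaussian functional.
\<close>
lemma deformed_sum_functional:
  assumes q: "norm q < 1"
  shows "deformed_sum q c = (1 - c * q^3) * deformed_sum q (c * q^6)"
proof -
  have q2: "norm (q^2) < 1" and q3: "norm (q^3) < 1" using q by (simp_all add: norm_power_less_one)
  define Q C X where "Q = fps_const q" and "C = fps_const c" and "X = (fps_X :: complex fps)"
  define W where "W = base_factor q"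
  define Y where "Y = fps_subst (c * q^6) 2 (qpoch_fps (q^2))"
  define Z where "Z = fps_subst (c * q^4) 2 (qpoch_fps (q^2))"
  define V where "V = fps_subst c 3 (inv_qpoch_fps (q^3))"
  \<comment> \<open>The series whose telescoping image is the required difference.\<close>
  define g where "g = C * (1 - X) * (Q^2 - X) * W * Z * V"
  have Z: "Z = (1 - C * Q^4 * X^2) * Y"
    unfolding Z_def Y_def C_def Q_def X_def
    by (subst subst_qpoch_fps[OF q2]) (simp_all add: fps_const_power fps_const_mult mult.assoc flip: power_add)
  have Z2: "fps_subst c 2 (qpoch_fps (q^2)) = (1 - C * X^2) * (1 - C * Q^2 * X^2) * Z"
    unfolding Z_def C_def Q_def X_def
    by (subst subst_qpoch_fps[OF q2], simp, subst subst_qpoch_fps[OF q2], simp)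
       (simp add: fps_const_power fps_const_mult mult.assoc flip: power_add)
  have V1: "fps_subst (c * q^3) 3 (inv_qpoch_fps (q^3)) = (1 - C * X^3) * V"
    unfolding V_def C_def X_def by (subst subst_inv_qpoch_fps[OF q3]) simp_all
  have V2: "fps_subst (c * q^6) 3 (inv_qpoch_fps (q^3)) = (1 - C * Q^3 * X^3) * (1 - C * X^3) * V"
    using subst_inv_qpoch_fps[OF q3, of 3 "c * q^3"]
    by (simp add: V1 mult.assoc C_def Q_def X_def fps_const_power fps_const_mult flip: power_add)
  have F: "param_factor q c * W = (1 - C * X^2) * (1 - C * Q^2 * X^2) * (1 - C * Q^4 * X^2) * (W * Y * V)"
    by (simp add: param_factor_def Z2 Z V_def mult_ac)
  have F6: "param_factor q (c * q^6) * W = (1 - C * Q^3 * X^3) * (1 - C * X^3) * (W * Y * V)"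
    by (simp add: param_factor_def V2 Y_def mult_ac)
  have sZ: "fps_subst q 1 Z = Y" and sV: "fps_subst q 1 V = (1 - C * X^3) * V"
    using V1 by (simp_all add: Z_def Y_def V_def fps_scale_subst mult.assoc flip: power_add del: One_nat_def)
  have sX: "fps_subst q 1 X = Q * X" by (simp add: X_def Q_def fps_subst_X)
  have sQ: "fps_subst q 1 (Q^2) = Q^2" by (simp add: Q_def fps_const_power)
  have sC: "fps_subst q 1 C = C" by (simp add: C_def)
  have "fps_subst q 1 g = C * (Q^2 - Q * X) * ((1 - Q * X) * fps_subst q 1 W) * Y * ((1 - C * X^3) * V)"
    by (simp add: g_def fps_subst_mult fps_subst_diff sX sZ sV sQ sC mult_ac del: One_nat_def)
  also have "(1 - Q * X) * fps_subst q 1 W = (1 - Q * X^2) * W"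
    unfolding W_def Q_def X_def by (rule base_factor_functional[OF q])
  finally have sg: "fps_subst q 1 g = (C * (Q^2 - Q * X) * (1 - Q * X^2) * (1 - C * X^3)) * (W * Y * V)"
    by (simp add: mult_ac)
  have g: "g = (C * (1 - X) * (Q^2 - X) * (1 - C * Q^4 * X^2)) * (W * Y * V)"
    by (simp add: g_def Z mult_ac)
  have "param_factor q c * W - (1 - C * Q^3) * (param_factor q (c * q^6) * W) = Q * fps_subst q 1 g + X * g"
  proof -
    have "param_factor q c * W - (1 - C * Q^3) * (param_factor q (c * q^6) * W)
        = ((1 - C * X^2) * (1 - C * Q^2 * X^2) * (1 - C * Q^4 * X^2) - (1 - C * Q^3) * (1 - C * Q^3 * X^3) * (1 - C * X^3)) * (W * Y * V)"
      unfolding F F6 by (simp only: left_diff_distrib mult.assoc)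
    also have "\<dots> = Q * fps_subst q 1 g + X * g"
      unfolding telescoping_polynomial sg by (simp only: g distrib_right mult.assoc)
    finally show ?thesis .
  qed
  moreover have "1 - C * Q^3 = fps_const (1 - c * q^3)"
    by (simp add: C_def Q_def fps_const_power fps_const_mult flip: fps_const_1_eq_1 fps_const_sub)
  ultimately have "gauss_sum q (param_factor q c * W - fps_const (1 - c * q^3) * (param_factor q (c * q^6) * W)) = gauss_sum q (fps_const q * fps_subst q 1 g + fps_X * g)"
    by (simp add: Q_def X_def)
  also have "\<dots> = 0"
  proof (rule gauss_sum_shift_zero[OF q])
    have "fps_conv_radius (1 - X) > 0" "fps_conv_radius (Q^2 - X) > 0"
      using fps_conv_radius_diff[of 1 X] fps_conv_radius_diff[of "Q^2" X]
      by (auto simp: X_def Q_def fps_const_power)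
    thus "fps_conv_radius g > 0"
      unfolding g_def using conv_radius_factors[OF q] q q2 q3
      by (auto intro!: fps_conv_radius_mult_pos fps_conv_radius_subst_pos fps_conv_radius_qpoch_fps
            fps_conv_radius_inv_qpoch_fps simp: C_def W_def Z_def V_def)
  qed
  finally show ?thesis
    using conv_radius_factors[OF q] fps_conv_radius_mult_pos
    by (simp add: gauss_sum_diff gauss_sum_const_mult q fps_conv_radius_mult_pos deformed_sum_def W_def)
qed

section \<open>Expansion in powers of the deformation parameter\<close>

text \<open>
  Applying the Gaussian functional to \<open>z\<^sup>n\<close> times the base factor gives the weight of index \<open>n\<close>
  times this quantity, which tends to \<open>1\<close> because only the constant coefficient of the base factor
  survives for large \<open>n\<close>.
\<close>
definition tail_factor :: "complex \<Rightarrow> nat \<Rightarrow> complex" where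
  "tail_factor q n = (\<Sum>s. fps_nth (base_factor q) s * gauss_weight q s * q ^ (n * s))"

lemma tail_factor_summable:
  assumes q: "norm q < 1"
  shows "summable (\<lambda>s. norm (fps_nth (base_factor q) s * gauss_weight q s * q ^ (n * s)))"
    and "norm (fps_nth (base_factor q) s * gauss_weight q s * q ^ (n * s)) \<le> norm (fps_nth (base_factor q) s) * norm q ^ (Suc s choose 2)"
proof -
  show le: "norm (fps_nth (base_factor q) s * gauss_weight q s * q ^ (n * s)) \<le> norm (fps_nth (base_factor q) s) * norm q ^ (Suc s choose 2)" for s
  proof -
    have "norm (fps_nth (base_factor q) s * gauss_weight q s * q ^ (n * s))
        = norm (fps_nth (base_factor q) s) * norm q ^ (Suc s choose 2) * norm q ^ (n * s)"
      by (simp add: norm_mult norm_gauss_weight norm_power)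
    also have "\<dots> \<le> norm (fps_nth (base_factor q) s) * norm q ^ (Suc s choose 2) * 1"
      using q by (intro mult_left_mono power_le_one) auto
    finally show ?thesis by simp
  qed
  show "summable (\<lambda>s. norm (fps_nth (base_factor q) s * gauss_weight q s * q ^ (n * s)))"
    by (rule summable_comparison_test'[OF gaussian_norm_summable[OF q conv_radius_factors(1)[OF q]], of 0])
       (use le in simp)
qed

lemma tail_factor_bounded:
  assumes q: "norm q < 1"
  shows "norm (tail_factor q n) \<le> (\<Sum>s. norm (fps_nth (base_factor q) s) * norm q ^ (Suc s choose 2))"
  unfolding tail_factor_def
  by (rule order.trans[OF summable_norm[OF tail_factor_summable(1)[OF q]]])
     (intro suminf_le tail_factor_summable gaussian_norm_summable conv_radius_factors q)

lemma tail_factor_tendsto: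
  assumes q: "norm q < 1"
  shows "tail_factor q \<longlonglongrightarrow> 1"
proof -
  define b where "b s = (if s = 0 then 1 else 0 :: complex)" for s :: nat
  have W0: "fps_nth (base_factor q) 0 = 1"
    by (simp add: base_factor_def fps_nth_subst qpoch_fps_def inv_qpoch_fps_def)
  have lim: "(\<lambda>n. fps_nth (base_factor q) s * gauss_weight q s * q ^ (n * s)) \<longlonglongrightarrow> b s" for s
  proof (cases "s = 0")
    case True
    thus ?thesis by (simp add: W0 b_def)
  next
    case False
    have "(\<lambda>n. (q ^ s) ^ n) \<longlonglongrightarrow> 0"
      by (rule LIMSEQ_power_zero) (use q False norm_power_less_one in auto)
    hence "(\<lambda>n. fps_nth (base_factor q) s * gauss_weight q s * (q ^ s) ^ n) \<longlonglongrightarrow> 0"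
      by (rule tendsto_mult_right_zero)
    thus ?thesis using False by (simp add: b_def mult.commute flip: power_mult)
  qed
  have "((\<lambda>n. \<Sum>s. fps_nth (base_factor q) s * gauss_weight q s * q ^ (n * s)) \<longlonglongrightarrow> suminf b)"
    using tannerys_theorem[OF lim _ gaussian_norm_summable[OF q conv_radius_factors(1)[OF q]] sequentially_bot]
      tail_factor_summable(2)[OF q] by (auto simp: always_eventually split_beta)
  moreover have "suminf b = 1" using suminf_finite[of "{0}" b] by (simp add: b_def)
  ultimately show ?thesis by (simp add: tail_factor_def [abs_def])
qed

lemma gauss_sum_base_factor:
  assumes q: "norm q < 1" and f: "fps_conv_radius f > 0"
  shows "gauss_sum q (f * base_factor q) = (\<Sum>n. fps_nth f n * (gauss_weight q n * tail_factor q n))"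
proof -
  have "((\<lambda>(i, s). fps_nth f i * fps_nth (base_factor q) s * gauss_weight q (i + s)) has_sum gauss_sum q (f * base_factor q)) (UNIV \<times> UNIV)"
    using gaussian_double_sum[OF q _ f conv_radius_factors(1)[OF q], of "gauss_weight q" 1]
    by (simp add: norm_gauss_weight gauss_sum_def)
  hence "((\<lambda>n. fps_nth f n * (gauss_weight q n * tail_factor q n)) has_sum gauss_sum q (f * base_factor q)) UNIV"
  proof (rule has_sum_SigmaD)
    fix i
    have "((\<lambda>s. fps_nth (base_factor q) s * gauss_weight q s * q ^ (i * s)) has_sum tail_factor q i) UNIV"
      using tail_factor_summable(1)[OF q]
      by (intro norm_summable_imp_has_sum) (auto simp: tail_factor_def intro: summable_sums summable_norm_cancel)
    hence "((\<lambda>s. fps_nth f i * gauss_weight q i * (fps_nth (base_factor q) s * gauss_weight q s * q ^ (i * s))) has_sum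
        (fps_nth f i * gauss_weight q i * tail_factor q i)) UNIV"
      by (rule has_sum_cmult_right)
    thus "((\<lambda>s. case (i, s) of (i, s) \<Rightarrow> fps_nth f i * fps_nth (base_factor q) s * gauss_weight q (i + s)) has_sum
        fps_nth f i * (gauss_weight q i * tail_factor q i)) UNIV"
      by (simp add: gauss_weight_add mult_ac)
  qed
  thus ?thesis by (rule has_sum_imp_suminf [symmetric])
qed

text \<open>
  Substituting \<open>z\<^sup>d\<close> makes a series sparse; this discards the vanishing terms.
\<close>
lemma has_sum_dilate:
  fixes F :: "nat \<times> nat \<Rightarrow> complex"
  assumes F: "(F has_sum S) UNIV" and d: "d > 0" "e > 0"
    and 0: "\<And>i j. \<not> (d dvd i \<and> e dvd j) \<Longrightarrow> F (i, j) = 0"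
  shows "((\<lambda>(k, l). F (d * k, e * l)) has_sum S) UNIV"
proof -
  let ?h = "\<lambda>(k, l). (d * k, e * l)"
  have "(F has_sum S) (range ?h) = (F has_sum S) UNIV"
    using 0 by (intro has_sum_cong_neutral) (force simp: image_iff dvd_def)+
  hence "(F has_sum S) (range ?h)" using F by simp
  moreover have "inj ?h" using d by (auto simp: inj_def)
  ultimately have "((F \<circ> ?h) has_sum S) UNIV" by (simp add: has_sum_reindex)
  thus ?thesis by (simp add: o_def case_prod_unfold)
qed

text \<open>
  The coefficient of \<open>c\<^sup>m\<close> in the deformed sum: \<open>j\<close> factors \<open>c\<close> come with \<open>z\<^sup>3\<close> and \<open>m - j\<close> of them
  with \<open>z\<^sup>2\<close>, in total with \<open>z\<^bsup>2m+j\<^esup>\<close>.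
\<close>
definition param_coeff :: "complex \<Rightarrow> nat \<Rightarrow> complex" where
  "param_coeff q m = (\<Sum>j\<le>m. fps_nth (inv_qpoch_fps (q^3)) j * fps_nth (qpoch_fps (q^2)) (m - j)
      * (gauss_weight q (2 * m + j) * tail_factor q (2 * m + j)))"

lemma deformed_sum_sums:
  assumes q: "norm q < 1"
  shows "(\<lambda>m. param_coeff q m * c ^ m) sums deformed_sum q c"
proof -
  have q2: "norm (q^2) < 1" and q3: "norm (q^3) < 1" using q by (simp_all add: norm_power_less_one)
  define f where "f = fps_subst c 3 (inv_qpoch_fps (q^3))"
  define g where "g = fps_subst c 2 (qpoch_fps (q^2))"
  define \<Omega> where "\<Omega> n = gauss_weight q n * tail_factor q n" for n
  define M where "M = (\<Sum>s. norm (fps_nth (base_factor q) s) * norm q ^ (Suc s choose 2))"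
  have "norm (\<Omega> n) \<le> M * norm q ^ (Suc n choose 2)" for n
    using mult_right_mono[OF tail_factor_bounded[OF q, of n], of "norm q ^ (Suc n choose 2)"]
    by (simp add: \<Omega>_def norm_mult norm_gauss_weight M_def mult_ac)
  moreover have r: "fps_conv_radius f > 0" "fps_conv_radius g > 0"
    unfolding f_def g_def using q2 q3
    by (auto intro!: fps_conv_radius_subst_pos fps_conv_radius_qpoch_fps fps_conv_radius_inv_qpoch_fps)
  ultimately have "((\<lambda>(i, j). fps_nth f i * fps_nth g j * \<Omega> (i + j)) has_sum (\<Sum>n. fps_nth (f * g) n * \<Omega> n)) UNIV"
    by (intro gaussian_double_sum[OF q])
  also have "(\<Sum>n. fps_nth (f * g) n * \<Omega> n) = deformed_sum q c"
    using gauss_sum_base_factor[OF q conv_radius_factors(2)[OF q], of c]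
    by (simp add: deformed_sum_def \<Omega>_def param_factor_def f_def g_def)
  finally have "((\<lambda>(k, l). (\<lambda>(i, j). fps_nth f i * fps_nth g j * \<Omega> (i + j)) (3 * k, 2 * l)) has_sum deformed_sum q c) UNIV"
    by (rule has_sum_dilate) (auto simp: f_def g_def fps_nth_subst)
  hence "((\<lambda>(k, l). (fps_nth (inv_qpoch_fps (q^3)) k * c ^ k) * (fps_nth (qpoch_fps (q^2)) l * c ^ l) * \<Omega> (3 * k + 2 * l)) has_sum deformed_sum q c) UNIV"
    by (simp add: f_def g_def fps_nth_subst)
  from has_sum_antidiagonal[OF this]
  have "((\<lambda>m. \<Sum>j\<le>m. (fps_nth (inv_qpoch_fps (q^3)) j * c ^ j) * (fps_nth (qpoch_fps (q^2)) (m - j) * c ^ (m - j)) * \<Omega> (3 * j + 2 * (m - j))) has_sum deformed_sum q c) UNIV"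
    by simp
  also have "(\<lambda>m. \<Sum>j\<le>m. (fps_nth (inv_qpoch_fps (q^3)) j * c ^ j) * (fps_nth (qpoch_fps (q^2)) (m - j) * c ^ (m - j)) * \<Omega> (3 * j + 2 * (m - j)))
      = (\<lambda>m. param_coeff q m * c ^ m)"
  proof
    fix m
    show "(\<Sum>j\<le>m. (fps_nth (inv_qpoch_fps (q^3)) j * c ^ j) * (fps_nth (qpoch_fps (q^2)) (m - j) * c ^ (m - j)) * \<Omega> (3 * j + 2 * (m - j)))
      = param_coeff q m * c ^ m"
      unfolding param_coeff_def sum_distrib_right
    proof (rule sum.cong, rule refl, goal_cases)
      case (1 j)
      then obtain k where "m = j + k" using le_Suc_ex by auto
      thus ?case by (simp add: \<Omega>_def power_add mult_ac)
    qed
  qed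
  finally show ?thesis by (rule has_sum_imp_sums)
qed

text \<open>
  The functional equation holds for all \<open>c\<close>, so it may be read off coefficientwise from the power
  series in \<open>c\<close>.
\<close>
lemma param_coeff_functional:
  assumes q: "norm q < 1"
  shows "param_coeff q (Suc m) * (1 - q ^ (6 * Suc m)) = - (q ^ (6 * m + 3) * param_coeff q m)"
proof -
  define A where "A = Abs_fps (param_coeff q)"
  have rad: "fps_conv_radius (Abs_fps f) = \<infinity>" if "\<And>z. summable (\<lambda>n. f n * z ^ n)" for f :: "nat \<Rightarrow> complex"
    unfolding fps_conv_radius_def using that by (simp add: conv_radius_inftyI'')
  have A: "eval_fps A z = deformed_sum q z" for z
    using deformed_sum_sums[OF q, of z] by (simp add: A_def eval_fps_def sums_iff)
  have rA: "fps_conv_radius A = \<infinity>"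
    unfolding A_def by (rule rad) (use deformed_sum_sums[OF q] in \<open>auto simp: sums_iff\<close>)
  define B where "B = fps_subst (q ^ 6) 1 A"
  have B: "eval_fps B z = deformed_sum q (z * q ^ 6)" for z
    unfolding A [symmetric] by (simp add: B_def eval_fps_def fps_nth_subst power_mult_distrib mult_ac)
  have "fps_conv_radius (Abs_fps (fps_nth B)) = \<infinity>"
    using deformed_sum_sums[OF q, of "_ * q ^ 6"]
    by (intro rad) (auto simp: B_def A_def fps_nth_subst power_mult_distrib mult_ac sums_iff)
  hence rB: "fps_conv_radius B = \<infinity>" by (simp add: fps_nth_inverse)
  define P where "P = 1 - fps_const (q ^ 3) * fps_X"
  have rP: "fps_conv_radius P = \<infinity>"
    unfolding P_def using fps_conv_radius_diff[of 1 "fps_const (q ^ 3) * fps_X"]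
      fps_conv_radius_mult[of "fps_const (q ^ 3)" fps_X] by simp
  have eP: "eval_fps P z = 1 - z * q ^ 3" for z
    unfolding P_def by (subst eval_fps_diff)
      (use fps_conv_radius_mult[of "fps_const (q ^ 3)" fps_X] in \<open>simp_all add: eval_fps_mult mult_ac\<close>)
  have "A = P * B"
  proof (rule eval_fps_eqD)
    show "fps_conv_radius A > 0" by (simp add: rA)
    show "fps_conv_radius (P * B) > 0" by (rule fps_conv_radius_mult_pos) (simp_all add: rP rB)
    have "eval_fps A z = eval_fps (P * B) z" for z
      using deformed_sum_functional[OF q, of z] by (simp add: eval_fps_mult rP rB eP A B)
    thus "\<forall>\<^sub>F z in nhds 0. eval_fps A z = eval_fps (P * B) z" by simp
  qed
  hence "fps_nth A (Suc m) = fps_nth (P * B) (Suc m)" by simp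
  hence "param_coeff q (Suc m) = param_coeff q (Suc m) * (q ^ 6) ^ Suc m - q ^ 3 * (param_coeff q m * (q ^ 6) ^ m)"
    by (simp add: P_def left_diff_distrib mult.assoc B_def A_def fps_nth_subst)
  thus ?thesis by (simp add: algebra_simps power_add flip: power_mult)
qed

section \<open>Evaluation of the deformed sum\<close>

text \<open>
  The coefficients of the deformed sum without their leading behaviour \<open>(-1)\<^sup>m q\<^bsup>3m\<^sup>2\<^esup>\<close>. After this
  normalisation they have a nonzero limit.
\<close>
definition reduced_coeff :: "complex \<Rightarrow> nat \<Rightarrow> complex" where
  "reduced_coeff q m = (\<Sum>j\<le>m. q ^ (3 * (Suc j choose 2)) * tail_factor q (2 * m + j)
      / (qpoch (q^2) (q^2) (m - j) * qpoch (q^3) (q^3) j))"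

lemma two_choose_two: "2 * (k choose 2) + k = k * k"
  by (induction k) (simp_all add: choose_two_Suc)

text \<open>
  Completing the square: with \<open>m = k + j\<close>, the weight of index \<open>2m + j\<close> and the exponent
  \<open>k(k-1)\<close> from the series in \<open>q\<^sup>2\<close> add up to \<open>3m\<^sup>2\<close> plus an exponent that depends on \<open>j\<close> alone.
\<close>
lemma param_exponent:
  "(Suc (2 * (k + j) + j) choose 2) + 2 * (k choose 2) = 3 * (k + j)\<^sup>2 + 3 * (Suc j choose 2)"
proof -
  have "2 * ((Suc (2 * (k + j) + j) choose 2) + 2 * (k choose 2)) + 2 * k
      = 2 * (3 * (k + j)\<^sup>2 + 3 * (Suc j choose 2)) + 2 * k"
    using two_choose_two_Suc[of "2 * (k + j) + j"] two_choose_two[of k] two_choose_two_Suc[of j]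
    by (simp add: power2_eq_square algebra_simps)
  thus ?thesis by simp
qed

lemma param_coeff_eq: "param_coeff q m = (-1) ^ m * q ^ (3 * m\<^sup>2) * reduced_coeff q m"
  unfolding param_coeff_def reduced_coeff_def sum_distrib_left
proof (rule sum.cong, rule refl, goal_cases)
  case (1 j)
  then obtain k where m: "m = k + j" using le_Suc_ex by (metis add.commute atMost_iff)
  have "q ^ (Suc (2 * m + j) choose 2) * (q^2) ^ (k choose 2) = q ^ (3 * m\<^sup>2) * q ^ (3 * (Suc j choose 2))"
    unfolding power_mult [symmetric] power_add [symmetric] m param_exponent ..
  moreover have "(-1 :: complex) ^ (2 * m + j) * (-1) ^ k = (-1) ^ m"
    by (simp add: m power_add power_mult)
  ultimately have "((-1) ^ (2 * m + j) * (-1) ^ k) * (q ^ (Suc (2 * m + j) choose 2) * (q^2) ^ (k choose 2))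
      = (-1) ^ m * (q ^ (3 * m\<^sup>2) * q ^ (3 * (Suc j choose 2)))" by (simp only:)
  moreover have "m - j = k" by (simp add: m)
  ultimately show ?case
    by (simp add: qpoch_fps_def inv_qpoch_fps_def gauss_weight_def mult_ac)
qed

text \<open>
  The coefficientwise functional equation determines all coefficients from the one of index \<open>0\<close>.
  The hypothesis \<open>q \<noteq> 0\<close> allows division by \<open>q\<^bsup>3m\<^sup>2\<^esup>\<close>.
\<close>
lemma reduced_coeff_recurrence:
  assumes q: "norm q < 1" "q \<noteq> 0"
  shows "reduced_coeff q m * qpoch (q^6) (q^6) m = reduced_coeff q 0"
proof (induction m)
  case (Suc m)
  have e: "3 * (Suc m)\<^sup>2 = 3 * m\<^sup>2 + (6 * m + 3)" by (simp add: power2_eq_square)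
  have "((-1) ^ m * q ^ (3 * (Suc m)\<^sup>2)) * (reduced_coeff q (Suc m) * (1 - q ^ (6 * Suc m)))
      = ((-1) ^ m * q ^ (3 * (Suc m)\<^sup>2)) * reduced_coeff q m"
    using param_coeff_functional[OF q(1), of m] unfolding param_coeff_eq e power_add
    by (simp add: mult_ac)
  hence "reduced_coeff q (Suc m) * (1 - q ^ (6 * Suc m)) = reduced_coeff q m"
    using q by simp
  moreover have "reduced_coeff q (Suc m) * qpoch (q^6) (q^6) (Suc m)
      = (reduced_coeff q (Suc m) * (1 - q ^ (6 * Suc m))) * qpoch (q^6) (q^6) m"
    unfolding qpoch_Suc power_mult[of q 6 "Suc m"] power_Suc by (simp only: mult_ac)
  ultimately show ?case using Suc by simp
qed simp

text \<open>
  By Tannery's theorem the limit may be taken termwise. The factors with index \<open>m - j\<close> and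
  \<open>2m + j\<close> converge to constants, and the sum over \<open>j\<close> that is left is Euler's series for
  \<open>(-q\<^sup>3;q\<^sup>3)\<^sub>\<infinity>\<close>. The limit supplies the coefficient of index \<open>0\<close>, which the functional
  equation alone leaves undetermined.
\<close>
lemma reduced_coeff_tendsto:
  assumes q: "norm q < 1"
  shows "reduced_coeff q \<longlonglongrightarrow> qpoch_inf (-(q^3)) (q^3) / qpoch_inf (q^2) (q^2)"
proof -
  have q2: "norm (q^2) < 1" and q3: "norm (q^3) < 1" using q by (simp_all add: norm_power_less_one)
  obtain M2 where M2: "M2 > 0" "\<And>n. norm (1 / qpoch (q^2) (q^2) n) \<le> M2"
    using inverse_qpoch_bounded[OF q2 q2] by blast
  obtain M3 where M3: "M3 > 0" "\<And>n. norm (1 / qpoch (q^3) (q^3) n) \<le> M3"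
    using inverse_qpoch_bounded[OF q3 q3] by blast
  obtain T where T: "\<And>n. norm (tail_factor q n) \<le> T" using tail_factor_bounded[OF q] by blast
  have T0: "T \<ge> 0" using order.trans[OF norm_ge_zero T] .
  define e where "e j = q ^ (3 * (Suc j choose 2))" for j
  define a where "a j m = (if j \<le> m then e j * tail_factor q (2 * m + j) * (1 / qpoch (q^2) (q^2) (m - j)) * (1 / qpoch (q^3) (q^3) j) else 0)" for j m
  define b where "b j = e j * 1 * (1 / qpoch_inf (q^2) (q^2)) * (1 / qpoch (q^3) (q^3) j)" for j
  have lim: "(\<lambda>m. a j m) \<longlonglongrightarrow> b j" for j
  proof -
    have "(\<lambda>m. tail_factor q (2 * (m + j) + j)) \<longlonglongrightarrow> 1"
      by (rule filterlim_compose[OF tail_factor_tendsto[OF q]])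
         (rule filterlim_at_top_mono[OF filterlim_ident], auto)
    hence "(\<lambda>m. e j * tail_factor q (2 * (m + j) + j) * (1 / qpoch (q^2) (q^2) m) * (1 / qpoch (q^3) (q^3) j)) \<longlonglongrightarrow> b j"
      unfolding b_def by (intro tendsto_mult tendsto_const inverse_qpoch_tendsto q2)
    hence "(\<lambda>m. a j (m + j)) \<longlonglongrightarrow> b j" by (simp add: a_def)
    thus ?thesis by (rule LIMSEQ_offset)
  qed
  define K where "K j = norm (e j) * (T * M2 * M3)" for j
  have bound: "norm (a j m) \<le> K j" for j m
  proof (cases "j \<le> m")
    case True
    hence "norm (a j m) = norm (e j) * (norm (tail_factor q (2 * m + j)) * norm (1 / qpoch (q^2) (q^2) (m - j)) * norm (1 / qpoch (q^3) (q^3) j))"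
      by (simp add: a_def norm_mult norm_divide mult_ac)
    also have "\<dots> \<le> K j"
      unfolding K_def using T T0 M2 M3 by (intro mult_left_mono mult_mono) auto
    finally show ?thesis .
  next
    case False
    thus ?thesis using T0 M2 M3 by (simp add: a_def K_def)
  qed
  have K: "summable K"
  proof -
    have "fps_conv_radius (Abs_fps (\<lambda>_. 1) :: complex fps) > 0"
      unfolding fps_conv_radius_pos_iff by (intro exI[of _ 1]) simp
    from gaussian_norm_summable[OF q3 this]
    have "summable (\<lambda>j. norm (e j))"
      by (simp add: e_def norm_power power_mult)
    thus ?thesis unfolding K_def by (rule summable_mult2)
  qed
  have "(\<lambda>m. \<Sum>j. a j m) \<longlonglongrightarrow> suminf b"
    using tannerys_theorem[OF lim _ K sequentially_bot] bound by (auto simp: always_eventually split_beta)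
  also have "(\<lambda>m. \<Sum>j. a j m) = reduced_coeff q"
  proof
    fix m
    have "(\<Sum>j. a j m) = (\<Sum>j\<le>m. a j m)" by (rule suminf_finite) (auto simp: a_def)
    thus "(\<Sum>j. a j m) = reduced_coeff q m"
      by (simp add: a_def e_def reduced_coeff_def)
  qed
  also have "suminf b = qpoch_inf (-(q^3)) (q^3) / qpoch_inf (q^2) (q^2)"
  proof -
    have t: "(-1) ^ j * (q^3) ^ (j choose 2) * (-(q^3)) ^ j / qpoch (q^3) (q^3) j = e j / qpoch (q^3) (q^3) j" for j
    proof -
      have "(-1) ^ j * (q^3) ^ (j choose 2) * (-(q^3)) ^ j = (q^3) ^ (j choose 2) * (q^3) ^ j"
        by (subst power_minus[of "q^3"]) (simp flip: power_mult_distrib)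
      also have "\<dots> = e j"
        by (simp add: e_def choose_two_Suc add.commute flip: power_mult power_add)
      finally show ?thesis by simp
    qed
    have "(\<lambda>j. (1 / qpoch_inf (q^2) (q^2)) * (e j / qpoch (q^3) (q^3) j)) sums ((1 / qpoch_inf (q^2) (q^2)) * qpoch_inf (-(q^3)) (q^3))"
      using euler_product_sums[OF q3, of "-(q^3)"] unfolding t by (rule sums_mult)
    thus ?thesis by (simp add: b_def [abs_def] sums_iff)
  qed
  finally show ?thesis .
qed

text \<open>
  Comparing the recurrence with the limit gives the coefficient of index \<open>0\<close> as
  \<open>(q\<^sup>6;q\<^sup>6) (-q\<^sup>3;q\<^sup>3) / (q\<^sup>2;q\<^sup>2)\<close>. The remaining sum over \<open>m\<close> is Euler's series in base \<open>q\<^sup>6\<close>,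
  evaluated at \<open>w = q\<^sup>4\<close> when \<open>c = q\<close>. The factors \<open>(q\<^sup>4;q\<^sup>6)\<close> and \<open>(q\<^sup>6;q\<^sup>6)\<close> then cancel against
  the trisection of \<open>(q\<^sup>2;q\<^sup>2)\<close>.
\<close>
lemma deformed_sum_at_base:
  assumes q: "norm q < 1" "q \<noteq> 0"
  shows "deformed_sum q q = 1 / (qpoch_inf (q\<^sup>2) (q ^ 6) * qpoch_inf (q ^ 3) (q ^ 6))"
proof -
  have q2: "norm (q^2) < 1" and q3: "norm (q^3) < 1" and q4: "norm (q^4) < 1" and q6: "norm (q^6) < 1"
    using q by (simp_all add: norm_power_less_one)
  note nz = qpoch_inf_nonzero[OF q2 q6] qpoch_inf_nonzero[OF q3 q6] qpoch_inf_nonzero[OF q4 q6]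
    qpoch_inf_nonzero[OF q6 q6] qpoch_inf_nonzero[OF q2 q2]
  define L where "L = qpoch_inf (-(q^3)) (q^3) / qpoch_inf (q^2) (q^2)"
  have "(\<lambda>m. reduced_coeff q m * qpoch (q^6) (q^6) m) \<longlonglongrightarrow> L * qpoch_inf (q^6) (q^6)"
    unfolding L_def by (intro tendsto_mult reduced_coeff_tendsto qpoch_tendsto q q6)
  hence B0: "reduced_coeff q 0 = L * qpoch_inf (q^6) (q^6)"
    by (simp add: reduced_coeff_recurrence[OF q] LIMSEQ_const_iff)
  have "(\<lambda>m. reduced_coeff q 0 * ((-1) ^ m * (q^6) ^ (m choose 2) * (q^4) ^ m / qpoch (q^6) (q^6) m)) sums
      (reduced_coeff q 0 * qpoch_inf (q^4) (q^6))"
    by (intro sums_mult euler_product_sums q6)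
  also have "(\<lambda>m. reduced_coeff q 0 * ((-1) ^ m * (q^6) ^ (m choose 2) * (q^4) ^ m / qpoch (q^6) (q^6) m))
      = (\<lambda>m. param_coeff q m * q ^ m)"
  proof
    fix m
    have "6 * (m choose 2) + 4 * m = 3 * m\<^sup>2 + m"
      using two_choose_two[of m] by (simp add: power2_eq_square)
    hence "(q^6) ^ (m choose 2) * (q^4) ^ m = q ^ (3 * m\<^sup>2) * q ^ m"
      by (simp only: power_mult [symmetric] power_add [symmetric])
    moreover have "reduced_coeff q 0 / qpoch (q^6) (q^6) m = reduced_coeff q m"
      using reduced_coeff_recurrence[OF q, of m] qpoch_nonzero[OF q6 q6, of m] by (simp add: field_simps)
    moreover have "reduced_coeff q 0 * ((-1) ^ m * (q^6) ^ (m choose 2) * (q^4) ^ m / qpoch (q^6) (q^6) m)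
      = (-1) ^ m * ((q^6) ^ (m choose 2) * (q^4) ^ m) * (reduced_coeff q 0 / qpoch (q^6) (q^6) m)" by simp
    ultimately show "reduced_coeff q 0 * ((-1) ^ m * (q^6) ^ (m choose 2) * (q^4) ^ m / qpoch (q^6) (q^6) m) = param_coeff q m * q ^ m"
      by (simp add: param_coeff_eq mult_ac)
  qed
  finally have "deformed_sum q q = L * qpoch_inf (q^6) (q^6) * qpoch_inf (q^4) (q^6)"
    using deformed_sum_sums[OF q(1), of q] sums_unique2 B0 by metis
  moreover have "qpoch_inf (q^2) (q^2) = qpoch_inf (q^2) (q^6) * qpoch_inf (q^4) (q^6) * qpoch_inf (q^6) (q^6)"
    using qpoch_inf_trisect[OF q2, of "q^2"] by (simp flip: power_mult power_add)
  moreover have "qpoch_inf (-(q^3)) (q^3) = 1 / qpoch_inf (q^3) (q^6)"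
    using euler_odd_parts[OF q3] nz by (simp add: field_simps flip: power_mult)
  ultimately show ?thesis using nz by (simp add: L_def field_simps)
qed

section \<open>The double sum\<close>

lemma theorem_exponent:
  "(Suc (i + 3 * j) choose 2) + (i choose 2) + i + j = 3 * j * (3 * j + 1) div 2 + i\<^sup>2 + 3 * i * j + i + j"
proof -
  have "2 * ((Suc (i + 3 * j) choose 2) + (i choose 2)) + i = 3 * j * (3 * j + 1) + 2 * (i\<^sup>2 + 3 * i * j) + i"
    using two_choose_two_Suc[of "i + 3 * j"] two_choose_two[of i]
    by (simp add: power2_eq_square algebra_simps)
  moreover have "even (3 * j * (3 * j + 1))" by simp
  ultimately show ?thesis by (auto elim!: evenE)
qed

theorem theorem1p4:
  fixes q :: complex
  assumes "norm q < 1"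
  shows "((\<lambda>(i, j). (-1) ^ j * q ^ (3 * j * (3 * j + 1) div 2 + i\<^sup>2 + 3 * i * j + i + j)
             / (qpoch q q i * qpoch (q ^ 3) (q ^ 3) j))
          has_sum (1 / (qpoch_inf (q\<^sup>2) (q ^ 6) * qpoch_inf (q ^ 3) (q ^ 6))))
          (UNIV :: (nat \<times> nat) set)"
proof (cases "q = 0")
  case True
  have "((\<lambda>(i, j). (-1) ^ j * q ^ (3 * j * (3 * j + 1) div 2 + i\<^sup>2 + 3 * i * j + i + j)
             / (qpoch q q i * qpoch (q ^ 3) (q ^ 3) j)) has_sum 1) {(0, 0)}"
    by (rule has_sum_finiteI) auto
  hence "((\<lambda>(i, j). (-1) ^ j * q ^ (3 * j * (3 * j + 1) div 2 + i\<^sup>2 + 3 * i * j + i + j)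
             / (qpoch q q i * qpoch (q ^ 3) (q ^ 3) j)) has_sum 1) (UNIV :: (nat \<times> nat) set)"
    by (rule has_sum_cong_neutral[THEN iffD1, rotated -1]) (auto simp: True)
  thus ?thesis by (simp add: True qpoch_inf_def)
next
  case False
  note q = assms
  have q2: "norm (q^2) < 1" and q3: "norm (q^3) < 1" using q by (simp_all add: norm_power_less_one)
  define f where "f = fps_subst q 1 (qpoch_fps q)"
  define g where "g = fps_subst q 3 (inv_qpoch_fps (q^3))"
  \<comment> \<open>At \<open>c = q\<close> the two factors in \<open>q z\<^sup>2\<close> with base \<open>q\<^sup>2\<close> cancel.\<close>
  have "param_factor q q * base_factor q = (fps_subst q 2 (inv_qpoch_fps (q^2)) * fps_subst q 2 (qpoch_fps (q^2))) * (f * g)"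
    by (simp add: param_factor_def base_factor_def f_def g_def mult_ac)
  hence "deformed_sum q q = (\<Sum>n. fps_nth (f * g) n * gauss_weight q n)"
    by (simp add: deformed_sum_def inv_qpoch_fps_subst_inverse[OF q2] gauss_sum_def)
  moreover have "((\<lambda>(i, j). fps_nth f i * fps_nth g j * gauss_weight q (i + j)) has_sum (\<Sum>n. fps_nth (f * g) n * gauss_weight q n)) UNIV"
    by (rule gaussian_double_sum[OF q, where M = 1])
       (use q q3 in \<open>auto simp: norm_gauss_weight f_def g_def intro!: fps_conv_radius_subst_pos fps_conv_radius_qpoch_fps fps_conv_radius_inv_qpoch_fps\<close>)
  ultimately have "((\<lambda>(i, j). fps_nth f i * fps_nth g j * gauss_weight q (i + j)) has_sum deformed_sum q q) UNIV"
    by simp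
  hence "((\<lambda>(k, l). (\<lambda>(i, j). fps_nth f i * fps_nth g j * gauss_weight q (i + j)) (1 * k, 3 * l)) has_sum deformed_sum q q) UNIV"
    by (rule has_sum_dilate) (auto simp: g_def fps_nth_subst)
  also have "(\<lambda>(k, l). (\<lambda>(i, j). fps_nth f i * fps_nth g j * gauss_weight q (i + j)) (1 * k, 3 * l))
    = (\<lambda>(i, j). (-1) ^ j * q ^ (3 * j * (3 * j + 1) div 2 + i\<^sup>2 + 3 * i * j + i + j)
             / (qpoch q q i * qpoch (q ^ 3) (q ^ 3) j))"
  proof (rule ext, clarify)
    fix i j
    have "q ^ (Suc (i + 3 * j) choose 2) * q ^ (i choose 2) * q ^ i * q ^ j
        = q ^ (3 * j * (3 * j + 1) div 2 + i\<^sup>2 + 3 * i * j + i + j)"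
      by (simp only: power_add [symmetric] theorem_exponent)
    moreover have "(-1 :: complex) ^ i * (-1) ^ (i + 3 * j) = (-1) ^ j"
      by (simp add: power_add power_mult flip: power_mult_distrib)
    moreover have "fps_nth f (1 * i) * fps_nth g (3 * j) * gauss_weight q (1 * i + 3 * j)
      = ((-1) ^ i * (-1) ^ (i + 3 * j)) * (q ^ (Suc (i + 3 * j) choose 2) * q ^ (i choose 2) * q ^ i * q ^ j)
        / (qpoch q q i * qpoch (q ^ 3) (q ^ 3) j)"
      by (simp add: f_def g_def fps_nth_subst qpoch_fps_def inv_qpoch_fps_def gauss_weight_def mult_ac)
    ultimately show "fps_nth f (1 * i) * fps_nth g (3 * j) * gauss_weight q (1 * i + 3 * j)
      = (-1) ^ j * q ^ (3 * j * (3 * j + 1) div 2 + i\<^sup>2 + 3 * i * j + i + j)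
             / (qpoch q q i * qpoch (q ^ 3) (q ^ 3) j)" by simp
  qed
  finally show ?thesis using deformed_sum_at_base[OF q False] by simp
qed

end
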